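(* Fix an integer $k\ge1$ and $\overline\alpha,\overline\beta,\overline\pi,\overline\tau\in\mathbb{R}_+^k$ with $\alpha_1,\beta_1>0$. Let $\{\upsilon_n=\lambda^{(n)}/\mu^{(n)}\}$ be a sequence of connected skew shapes such that $\lambda^{(n)}\to(\overline\alpha,\overline\beta)$ and $\mu^{(n)}\to(\overline\pi,\overline\tau)$ in the sense of Thoma–Vershik–Kerov limits. Then $$\log e(\upsilon_n)=c\,n+o(n)\qquad\text{as } n\to\infty,$$ where $$c=\gamma\log\gamma-\sum_{i=1}^k(\alpha_i-\pi_i)\log(\alpha_i-\pi_i)-\sum_{i=1}^k(\beta_i-\tau_i)\log(\beta_i-\tau_i),\qquad \gamma=\sum_{i=1}^k(\alpha_i+\beta_i-\pi_i-\tau_i).$$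
   Context: $e(\lambda/\mu)$ is the number of standard Young tableaux of skew shape $\lambda/\mu$; $\log$ is the natural logarithm, with the convention $0\log 0=0$; $\mathbb{R}_+=[0,\infty)$. $d(\lambda)$ is the size of the Durfee square of $\lambda$ (the largest $d$ such that the $d\times d$ square fits in the Young diagram of $\lambda$). The Frobenius coordinates of $\lambda$ are $a_i=\lambda_i-i$ and $b_i=\lambda'_i-i$ for $1\le i\le d(\lambda)$, and $a_i=b_i=0$ for $i>d(\lambda)$. A sequence of partitions $\{\lambda^{(n)}\}$ has Thoma–Vershik–Kerov limit $(\overline\alpha,\overline\beta)$, written $\lambda^{(n)}\to(\overline\alpha,\overline\beta)$, with $\overline\alpha=(\alpha_1,\ldots,\alpha_k)$, $\overline\beta=(\beta_1,\ldots,\beta_k)\in\mathbb{R}_+^k$, if $a_i(\lambda^{(n)})/n\to\alpha_i$ and $b_i(\lambda^{(n)})/n\to\beta_i$ as $n\to\infty$ for all $1\le i\le k$, and $d(\lambda^{(n)})\le k$ for all $n\ge1$. (The same $k$ is used for both sequences.) *)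

theory Defs
  imports Complex_Main "HOL-Library.FuncSet" "HOL-Library.Landau_Symbols"
begin

text \<open>
  A partition is the list of its positive parts in weakly decreasing order. Parts, rows and
  columns are numbered from 1, a cell is a pair (row, column), and rows grow downwards.
\<close>

definition is_partition :: "nat list \<Rightarrow> bool" where
  "is_partition p \<longleftrightarrow> sorted_wrt (\<ge>) p \<and> 0 \<notin> set p"

definition part :: "nat list \<Rightarrow> nat \<Rightarrow> nat" where
  "part p i = (if 1 \<le> i \<and> i \<le> length p then p ! (i - 1) else 0)"

definition diagram :: "nat list \<Rightarrow> (nat \<times> nat) set" where
  "diagram p = {(i, j). 1 \<le> i \<and> 1 \<le> j \<and> j \<le> part p i}"

definition conj_part :: "nat list \<Rightarrow> nat \<Rightarrow> nat" where
  "conj_part p j = card {i. (i, j) \<in> diagram p}"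

definition durfee :: "nat list \<Rightarrow> nat" where
  "durfee p = (GREATEST d. {1..d} \<times> {1..d} \<subseteq> diagram p)"

text \<open>
  The subtractions of naturals do not truncate for a partition: the cell (i, i) lies in the
  diagram for i up to the size of the Durfee square, so row i and column i have length at least i.
\<close>

definition frobenius_arm :: "nat list \<Rightarrow> nat \<Rightarrow> nat" where
  "frobenius_arm p i = (if 1 \<le> i \<and> i \<le> durfee p then part p i - i else 0)"

definition frobenius_leg :: "nat list \<Rightarrow> nat \<Rightarrow> nat" where
  "frobenius_leg p i = (if 1 \<le> i \<and> i \<le> durfee p then conj_part p i - i else 0)"

text \<open>
  Vectors of length k are functions of which only the values at 1, ..., k matter; sequences of
  partitions start at n = 1.
\<close>

definition TVK_limit ::
  "nat \<Rightarrow> (nat \<Rightarrow> nat list) \<Rightarrow> (nat \<Rightarrow> real) \<Rightarrow> (nat \<Rightarrow> real) \<Rightarrow> bool" where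
  "TVK_limit k lam \<alpha> \<beta> \<longleftrightarrow>
     (\<forall>i\<in>{1..k}.
        (\<lambda>n. real (frobenius_arm (lam n) i) / real n) \<longlonglongrightarrow> \<alpha> i \<and>
        (\<lambda>n. real (frobenius_leg (lam n) i) / real n) \<longlonglongrightarrow> \<beta> i) \<and>
     (\<forall>n\<ge>1. durfee (lam n) \<le> k)"

definition is_skew_shape :: "nat list \<Rightarrow> nat list \<Rightarrow> bool" where
  "is_skew_shape lam mu \<longleftrightarrow> is_partition lam \<and> is_partition mu \<and> diagram mu \<subseteq> diagram lam"

definition skew_diagram :: "nat list \<Rightarrow> nat list \<Rightarrow> (nat \<times> nat) set" where
  "skew_diagram lam mu = diagram lam - diagram mu"

definition cells_adjacent :: "nat \<times> nat \<Rightarrow> nat \<times> nat \<Rightarrow> bool" where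
  "cells_adjacent c d \<longleftrightarrow>
     \<bar>int (fst c) - int (fst d)\<bar> + \<bar>int (snd c) - int (snd d)\<bar> = 1"

text \<open>
  Connectedness is through common edges of cells; a common corner is not enough. The empty
  set of cells counts as connected.
\<close>

definition cells_connected :: "(nat \<times> nat) set \<Rightarrow> bool" where
  "cells_connected S \<longleftrightarrow>
     (\<forall>c\<in>S. \<forall>d\<in>S. (c, d) \<in> {(x, y). x \<in> S \<and> y \<in> S \<and> cells_adjacent x y}\<^sup>*)"

text \<open>
  Tableaux are functions with value \<^term>\<open>undefined\<close> outside the shape, so that
  each filling of the shape is counted once.
\<close>

definition standard_tableaux :: "(nat \<times> nat) set \<Rightarrow> (nat \<times> nat \<Rightarrow> nat) set" where
  "standard_tableaux S =
     {T \<in> extensional S. bij_betw T S {1..card S} \<and>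
        (\<forall>i j j'. (i, j) \<in> S \<and> (i, j') \<in> S \<and> j < j' \<longrightarrow> T (i, j) < T (i, j')) \<and>
        (\<forall>i i' j. (i, j) \<in> S \<and> (i', j) \<in> S \<and> i < i' \<longrightarrow> T (i, j) < T (i', j))}"

definition num_SYT :: "nat list \<Rightarrow> nat list \<Rightarrow> nat" where
  "num_SYT lam mu = card (standard_tableaux (skew_diagram lam mu))"

text \<open>At x = 0 the product is 0, whatever the value of \<^term>\<open>ln (0::real)\<close>: this is the convention 0 log 0 = 0.\<close>

definition xlogx :: "real \<Rightarrow> real" where
  "xlogx x = x * ln x"

end

theory Submission
  imports Defs
begin

text \<open>
  If every Durfee square is at most k by k, the cells outside the k by k corner lie in k horizontal
  arms and k vertical legs. A standard tableau is determined by the set of entries of each row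
  i \<open>\<le>\<close> k and of each remaining column part, so the number of tableaux is at most a
  multinomial coefficient, and Stirling's formula gives the upper bound. For the lower bound, cut
  each arm and leg into L equal blocks and fill the shape in stages: the corner at stage 0, and at
  stage s the block number s - i of arm i and of leg i. The delay by i makes the blocks of one stage
  pairwise independent, so each stage contributes a full multinomial coefficient. Only
  O(k) of the stages are incomplete, hence the lower bound is at least the fraction (L - k) / L of
  the upper one, and L tends to infinity.
\<close>

section \<open>Counting standard tableaux by removing maximal cells\<close>

text \<open>Only cells of a common row or column are related, exactly the pairs that the tableau
  conditions constrain. The relation is not transitive. It makes sense on any set of cells, so the
  counting lemmas apply to single stages, which need not be skew shapes.\<close>

definition precedes :: "nat \<times> nat \<Rightarrow> nat \<times> nat \<Rightarrow> bool" where
  "precedes x y \<longleftrightarrow> fst x = fst y \<and> snd x < snd y \<or> snd x = snd y \<and> fst x < fst y"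

definition maximal_cells :: "(nat \<times> nat) set \<Rightarrow> (nat \<times> nat) set" where
  "maximal_cells S = {x \<in> S. \<forall>y\<in>S. \<not> precedes x y}"

lemma standard_tableaux_precedes:
  "standard_tableaux S = {T \<in> extensional S. bij_betw T S {1..card S} \<and>
     (\<forall>x\<in>S. \<forall>y\<in>S. precedes x y \<longrightarrow> T x < T y)}"
  unfolding standard_tableaux_def precedes_def by (auto 4 3)

lemma finite_standard_tableaux:
  assumes "finite S"
  shows "finite (standard_tableaux S)"
proof (rule finite_subset)
  show "standard_tableaux S \<subseteq> (\<Pi>\<^sub>E x\<in>S. {1..card S})"
    unfolding standard_tableaux_precedes by (auto simp: PiE_def dest: bij_betwE)
  show "finite (\<Pi>\<^sub>E x\<in>S. {1..card S})"
    using assms by (intro finite_PiE) auto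
qed

lemma card_standard_tableaux_empty: "card (standard_tableaux {}) = 1"
proof -
  have "standard_tableaux {} = {\<lambda>x. undefined}"
    by (auto simp: standard_tableaux_precedes bij_betw_def)
  thus ?thesis by simp
qed

text \<open>The branching rule: the largest entry sits in a maximal cell, and erasing it leaves a
  standard tableau of the remaining cells.\<close>

lemma card_standard_tableaux_rec:
  assumes "finite S" "S \<noteq> {}"
  shows "card (standard_tableaux S) =
    (\<Sum>x\<in>maximal_cells S. card (standard_tableaux (S - {x})))"
proof -
  let ?N = "card S"
  have N: "?N \<ge> 1" using assms by (simp add: Suc_leI card_gt_0_iff)
  let ?h = "\<lambda>(x, T). T(x := ?N)"
  have "bij_betw ?h (SIGMA x:maximal_cells S. standard_tableaux (S - {x})) (standard_tableaux S)"
  proof (rule bij_betw_imageI)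
    show "inj_on ?h (SIGMA x:maximal_cells S. standard_tableaux (S - {x}))"
    proof (rule inj_onI, clarify)
      fix x T y U
      assume x: "x \<in> maximal_cells S" and T: "T \<in> standard_tableaux (S - {x})"
        and y: "y \<in> maximal_cells S" and U: "U \<in> standard_tableaux (S - {y})"
        and eq: "T(x := ?N) = U(y := ?N)"
      have xS: "x \<in> S" and yS: "y \<in> S" using x y by (auto simp: maximal_cells_def)
      \<comment> \<open>The entry \<open>?N\<close> identifies the cell: all values of
        \<open>U\<close> on \<open>S - {y}\<close> are smaller.\<close>
      have "x = y"
      proof (rule ccontr)
        assume "x \<noteq> y"
        hence "U x = ?N" using fun_cong[OF eq, of x] by simp
        moreover have "bij_betw U (S - {y}) {1..card (S - {y})}"
          using U by (simp add: standard_tableaux_precedes)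
        from bij_betw_apply[OF this, of x] have "U x \<in> {1..card (S - {y})}" using xS \<open>x \<noteq> y\<close> by simp
        moreover have "card (S - {y}) < ?N" using yS assms(1) by (intro card_Diff1_less)
        ultimately show False by simp
      qed
      moreover have "T = U"
      proof
        fix z
        \<comment> \<open>Overwriting the value at \<open>x\<close> loses nothing, because
          extensionality had fixed it.\<close>
        have "W x = undefined" if "W \<in> standard_tableaux (S - {x})" for W
          by (rule extensional_arb[of _ "S - {x}"]) (use that in \<open>simp_all add: standard_tableaux_def\<close>)
        hence "T x = U x" using T U \<open>x = y\<close> by metis
        thus "T z = U z"
          using fun_cong[OF eq, of z] \<open>x = y\<close> by (cases "z = x") simp_all
      qed
      ultimately show "x = y \<and> T = U" by simp
    qed
    show "?h ` (SIGMA x:maximal_cells S. standard_tableaux (S - {x})) = standard_tableaux S"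
    proof (intro equalityI subsetI)
      fix V assume "V \<in> ?h ` (SIGMA x:maximal_cells S. standard_tableaux (S - {x}))"
      then obtain x T where x: "x \<in> maximal_cells S" and T: "T \<in> standard_tableaux (S - {x})"
        and V: "V = T(x := ?N)" by auto
      have xS: "x \<in> S" using x by (simp add: maximal_cells_def)
      have c: "card (S - {x}) = ?N - 1" using assms xS by simp
      have bT: "bij_betw T (S - {x}) {1..?N - 1}"
        using T c by (simp add: standard_tableaux_precedes)
      have "bij_betw V (S - {x}) {1..?N - 1}"
        using bT by (rule bij_betw_cong[THEN iffD1, rotated]) (simp add: V)
      moreover have "bij_betw V {x} {?N}" by (simp add: V bij_betw_def)
      ultimately have "bij_betw V ({x} \<union> (S - {x})) ({?N} \<union> {1..?N - 1})"
        using N by (intro bij_betw_combine) auto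
      moreover have "{?N} \<union> {1..?N - 1} = {1..?N}" using N by auto
      moreover have "{x} \<union> (S - {x}) = S" using xS by auto
      ultimately have "bij_betw V S {1..?N}" by simp
      moreover have "V \<in> extensional S"
        using T xS unfolding V by (auto simp: standard_tableaux_precedes extensional_def)
      moreover have "V y < V z" if "y \<in> S" "z \<in> S" "precedes y z" for y z
      proof -
        have "y \<noteq> x" using x that by (auto simp: maximal_cells_def)
        show ?thesis
        proof (cases "z = x")
          case True
          have "T y \<in> {1..?N - 1}" using bT \<open>y \<noteq> x\<close> that by (auto dest: bij_betwE)
          then show ?thesis using True \<open>y \<noteq> x\<close> N by (auto simp: V)
        next
          case False
          then show ?thesis using T \<open>y \<noteq> x\<close> that by (auto simp: V standard_tableaux_precedes)
        qed
      qed
      ultimately show "V \<in> standard_tableaux S" by (auto simp: standard_tableaux_precedes)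
    next
      fix V assume V: "V \<in> standard_tableaux S"
      hence bV: "bij_betw V S {1..?N}" and mono: "\<And>y z. y \<in> S \<Longrightarrow> z \<in> S \<Longrightarrow> precedes y z \<Longrightarrow> V y < V z"
        and ext: "V \<in> extensional S"
        by (auto simp: standard_tableaux_precedes)
      have "?N \<in> V ` S" using bV N by (auto simp: bij_betw_def)
      then obtain x where xS: "x \<in> S" and Vx: "V x = ?N" by auto
      have le: "V y \<le> ?N" if "y \<in> S" for y using bV that by (auto dest: bij_betwE)
      have "x \<in> maximal_cells S" using xS mono[OF xS] le by (auto simp: maximal_cells_def Vx not_less[symmetric])
      \<comment> \<open>Resetting the erased cell to \<open>undefined\<close> makes the restricted
        tableau extensional on \<open>S - {x}\<close>.\<close>
      moreover have "V(x := undefined) \<in> standard_tableaux (S - {x})"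
      proof -
        have "bij_betw V (S - {x}) ({1..?N} - {V x})"
          using bV xS inj_on_image_set_diff[of V S S "{x}"]
          by (auto simp: bij_betw_def intro: inj_on_subset)
        moreover have "{1..?N} - {V x} = {1..card (S - {x})}" using Vx xS assms N by auto
        ultimately have "bij_betw V (S - {x}) {1..card (S - {x})}" by simp
        hence "bij_betw (V(x := undefined)) (S - {x}) {1..card (S - {x})}"
          by (rule bij_betw_cong[THEN iffD1, rotated]) auto
        thus ?thesis using ext mono by (auto simp: standard_tableaux_precedes extensional_def)
      qed
      moreover have "?h (x, V(x := undefined)) = V" using Vx by auto
      ultimately show "V \<in> ?h ` (SIGMA x:maximal_cells S. standard_tableaux (S - {x}))"
        by (metis (no_types, lifting) SigmaI image_eqI)
    qed
  qed
  hence "card (standard_tableaux S) = card (SIGMA x:maximal_cells S. standard_tableaux (S - {x}))"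
    by (simp add: bij_betw_same_card)
  also have "\<dots> = (\<Sum>x\<in>maximal_cells S. card (standard_tableaux (S - {x})))"
    using assms by (intro card_SigmaI) (auto simp: maximal_cells_def intro: finite_standard_tableaux)
  finally show ?thesis .
qed

section \<open>Multinomial bounds from colourings of the cells\<close>

lemma prod_fact_remove:
  fixes col :: "'a \<Rightarrow> 'c"
  assumes "finite S" "finite C" "x \<in> S" "col x \<in> C"
  shows "(\<Prod>c\<in>C. fact (card {y\<in>S. col y = c}) :: nat) =
    card {y\<in>S. col y = col x} * (\<Prod>c\<in>C. fact (card {y\<in>S - {x}. col y = c}))"
proof -
  have 1: "{y\<in>S. col y = col x} = insert x {y\<in>S - {x}. col y = col x}" using assms by auto
  have 2: "card {y\<in>S. col y = col x} = Suc (card {y\<in>S - {x}. col y = col x})"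
    unfolding 1 using assms by (subst card_insert_disjoint) auto
  have "(\<Prod>c\<in>C - {col x}. fact (card {y\<in>S. col y = c}) :: nat) =
    (\<Prod>c\<in>C - {col x}. fact (card {y\<in>S - {x}. col y = c}))"
    by (intro prod.cong refl arg_cong[of _ _ "\<lambda>A. fact (card A)"]) auto
  thus ?thesis using assms by (simp add: prod.remove[of C "col x"] 2 algebra_simps)
qed

lemma sum_card_color_classes:
  assumes "finite S" "finite C" "\<And>x. x \<in> S \<Longrightarrow> col x \<in> C"
  shows "(\<Sum>c\<in>C. card {y\<in>S. col y = c}) = card S"
proof -
  have "card S = card (\<Union>c\<in>C. {y\<in>S. col y = c})"
    using assms(3) by (intro arg_cong[of _ _ card]) auto
  also have "\<dots> = (\<Sum>c\<in>C. card {y\<in>S. col y = c})"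
    using assms by (intro card_UN_disjoint) auto
  finally show ?thesis ..
qed

text \<open>The branching rule, weighted with \<open>m! = m (m - 1)!\<close> for the colour class of
  the erased cell. Both multinomial bounds follow by induction once the weights over the maximal
  cells are compared with \<open>card S\<close>.\<close>

lemma card_standard_tableaux_times_prod_fact:
  assumes "finite S" "S \<noteq> {}" "finite C" "\<And>x. x \<in> S \<Longrightarrow> col x \<in> C"
  shows "card (standard_tableaux S) * (\<Prod>c\<in>C. fact (card {y\<in>S. col y = c})) =
    (\<Sum>x\<in>maximal_cells S. card {y\<in>S. col y = col x} *
      (card (standard_tableaux (S - {x})) * (\<Prod>c\<in>C. fact (card {y\<in>S - {x}. col y = c}))))"
  unfolding card_standard_tableaux_rec[OF assms(1,2)] sum_distrib_right
  by (intro sum.cong refl, subst prod_fact_remove[of S C])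
     (use assms in \<open>auto simp: maximal_cells_def\<close>)

text \<open>Every colour class is a chain, hence contains at most one maximal cell, and the weights
  in the recursion add up to at most \<open>card S\<close>.\<close>

lemma card_standard_tableaux_le_multinomial:
  assumes "finite S" "finite C" "\<And>x. x \<in> S \<Longrightarrow> col x \<in> C"
    and "\<And>x y. x \<in> S \<Longrightarrow> y \<in> S \<Longrightarrow> col x = col y \<Longrightarrow> x \<noteq> y \<Longrightarrow> precedes x y \<or> precedes y x"
  shows "card (standard_tableaux S) * (\<Prod>c\<in>C. fact (card {y\<in>S. col y = c})) \<le> fact (card S)"
  using assms
proof (induction "card S" arbitrary: S)
  case 0
  then show ?case by (simp add: card_standard_tableaux_empty)
next
  case (Suc n)
  let ?P = "\<lambda>S. card (standard_tableaux S) * (\<Prod>c\<in>C. fact (card {y\<in>S. col y = c}))"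
  have ne: "S \<noteq> {}" using Suc.hyps(2) by auto
  have inj: "inj_on col (maximal_cells S)"
    using Suc.prems(4) unfolding inj_on_def maximal_cells_def by blast
  have "?P S = (\<Sum>x\<in>maximal_cells S. card {y\<in>S. col y = col x} * ?P (S - {x}))"
    using Suc.prems ne by (intro card_standard_tableaux_times_prod_fact) auto
  also have "\<dots> \<le> (\<Sum>x\<in>maximal_cells S. card {y\<in>S. col y = col x} * fact n)"
  proof (intro sum_mono mult_left_mono)
    fix x assume "x \<in> maximal_cells S"
    hence c: "card (S - {x}) = n" using Suc.hyps(2) Suc.prems(1) by (simp add: maximal_cells_def)
    have "?P (S - {x}) \<le> fact (card (S - {x}))"
      using c Suc.prems by (intro Suc.hyps(1)) auto
    thus "?P (S - {x}) \<le> fact n" using c by simp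
  qed auto
  also have "\<dots> = (\<Sum>c\<in>col ` maximal_cells S. card {y\<in>S. col y = c}) * fact n"
    by (simp add: sum.reindex[OF inj] sum_distrib_right)
  also have "\<dots> \<le> (\<Sum>c\<in>C. card {y\<in>S. col y = c}) * fact n"
    using Suc.prems by (intro mult_right_mono sum_mono2) (auto simp: maximal_cells_def)
  also have "\<dots> = fact (card S)"
    using Suc.prems by (subst sum_card_color_classes) (auto simp flip: Suc.hyps(2))
  finally show ?case .
qed

text \<open>Cells of different colours do not constrain each other, so every nonempty class contains
  a maximal cell of \<open>S\<close>, and the weights in the recursion add up to at least
  \<open>card S\<close>.\<close>

lemma multinomial_le_card_standard_tableaux:
  assumes "finite S" "finite C" "\<And>x. x \<in> S \<Longrightarrow> col x \<in> C"
    and "\<And>x y. x \<in> S \<Longrightarrow> y \<in> S \<Longrightarrow> precedes x y \<Longrightarrow> col x = col y"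
  shows "fact (card S) \<le> card (standard_tableaux S) * (\<Prod>c\<in>C. fact (card {y\<in>S. col y = c}))"
  using assms
proof (induction "card S" arbitrary: S)
  case 0
  then show ?case by (simp add: card_standard_tableaux_empty)
next
  case (Suc n)
  let ?P = "\<lambda>S. card (standard_tableaux S) * (\<Prod>c\<in>C. fact (card {y\<in>S. col y = c}))"
  have ne: "S \<noteq> {}" using Suc.hyps(2) by auto
  have fM: "finite (maximal_cells S)" using Suc.prems(1) by (simp add: maximal_cells_def)
  have max: "\<exists>x\<in>maximal_cells S. col x = col z" if "z \<in> S" for z
  proof -
    let ?K = "{y\<in>S. col y = col z}"
    \<comment> \<open>The coordinate sum grows along \<open>precedes\<close>, so a cell of the class
      with the largest sum is maximal in all of \<open>S\<close>.\<close>
    let ?m = "\<lambda>x :: nat \<times> nat. fst x + snd x"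
    have "z \<in> ?K" using that by simp
    hence "?K \<noteq> {}" by blast
    hence "Max (?m ` ?K) \<in> ?m ` ?K" using Suc.prems(1) by (intro Max_in) simp_all
    then obtain x where x: "x \<in> ?K" "Max (?m ` ?K) = ?m x" by blast
    have mx: "?m y \<le> ?m x" if "y \<in> ?K" for y
      unfolding x(2)[symmetric] using that Suc.prems(1) by (intro Max_ge) auto
    have "\<not> precedes x y" if "y \<in> S" for y
    proof
      assume p: "precedes x y"
      hence "y \<in> ?K" using Suc.prems(4)[of x y] x that by auto
      from mx[OF this] p show False by (auto simp: precedes_def)
    qed
    hence "x \<in> maximal_cells S" using x by (simp add: maximal_cells_def)
    thus ?thesis using x by blast
  qed
  have "fact (card S) = (\<Sum>c\<in>C. card {y\<in>S. col y = c}) * fact n"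
    using Suc.prems by (subst sum_card_color_classes) (auto simp flip: Suc.hyps(2))
  also have "(\<Sum>c\<in>C. card {y\<in>S. col y = c}) = (\<Sum>c\<in>col ` maximal_cells S. card {y\<in>S. col y = c})"
  proof (rule sum.mono_neutral_right)
    show "\<forall>c\<in>C - col ` maximal_cells S. card {y\<in>S. col y = c} = 0"
    proof
      fix c assume c: "c \<in> C - col ` maximal_cells S"
      have "col y \<noteq> c" if "y \<in> S" for y
        using max[OF that] c by (metis Diff_iff image_eqI)
      hence "{y\<in>S. col y = c} = {}" by simp
      thus "card {y\<in>S. col y = c} = 0" by (simp only: card.empty)
    qed
  qed (use Suc.prems(2,3) in \<open>auto simp: maximal_cells_def\<close>)
  \<comment> \<open>One colour may own several maximal cells; summing over cells instead of colours
    can only increase the total.\<close>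
  also have "\<dots> * fact n \<le> (\<Sum>x\<in>maximal_cells S. card {y\<in>S. col y = col x}) * fact n"
    using sum_image_le[OF fM, of "\<lambda>c. card {y\<in>S. col y = c}" col]
    by (intro mult_right_mono) (auto simp: o_def)
  also have "\<dots> = (\<Sum>x\<in>maximal_cells S. card {y\<in>S. col y = col x} * fact n)"
    by (simp add: sum_distrib_right)
  also have "\<dots> \<le> (\<Sum>x\<in>maximal_cells S. card {y\<in>S. col y = col x} * ?P (S - {x}))"
  proof (intro sum_mono mult_left_mono)
    fix x assume "x \<in> maximal_cells S"
    hence c: "card (S - {x}) = n" using Suc.hyps(2) Suc.prems(1) by (simp add: maximal_cells_def)
    have "fact (card (S - {x})) \<le> ?P (S - {x})"
      using c Suc.prems by (intro Suc.hyps(1)) auto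
    thus "fact n \<le> ?P (S - {x})" using c by simp
  qed auto
  also have "\<dots> = ?P S"
    using Suc.prems ne by (intro card_standard_tableaux_times_prod_fact[symmetric]) auto
  finally show ?case .
qed

text \<open>With a single colour the multinomial bound reads \<open>N! \<le> e N!\<close>, which
  forces a tableau to exist.\<close>

lemma card_standard_tableaux_pos:
  assumes "finite S"
  shows "card (standard_tableaux S) \<ge> 1"
  using multinomial_le_card_standard_tableaux[OF assms, of "{()}" "\<lambda>_. ()"] by simp

text \<open>Any filling of \<open>D\<close> can be followed by any filling of \<open>U\<close> with
  the larger entries.\<close>

lemma card_standard_tableaux_Un:
  assumes "finite D" "finite U" "D \<inter> U = {}"
    and "\<And>x y. x \<in> U \<Longrightarrow> y \<in> D \<Longrightarrow> \<not> precedes x y"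
  shows "card (standard_tableaux D) * card (standard_tableaux U) \<le> card (standard_tableaux (D \<union> U))"
  using assms
proof (induction "card U" arbitrary: U)
  case 0
  then show ?case by (simp add: card_standard_tableaux_empty)
next
  case (Suc n)
  have ne: "U \<noteq> {}" using Suc.hyps(2) by auto
  have "card (standard_tableaux D) * card (standard_tableaux U)
    = (\<Sum>x\<in>maximal_cells U. card (standard_tableaux D) * card (standard_tableaux (U - {x})))"
    using Suc.prems ne by (simp add: card_standard_tableaux_rec sum_distrib_left)
  also have "\<dots> \<le> (\<Sum>x\<in>maximal_cells U. card (standard_tableaux (D \<union> U - {x})))"
  proof (rule sum_mono)
    fix x assume x: "x \<in> maximal_cells U"
    hence "D \<union> U - {x} = D \<union> (U - {x})" using Suc.prems(3) by (auto simp: maximal_cells_def)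
    moreover have "card (standard_tableaux D) * card (standard_tableaux (U - {x}))
      \<le> card (standard_tableaux (D \<union> (U - {x})))"
      using x Suc.prems Suc.hyps(2) by (intro Suc.hyps(1)) (auto simp: maximal_cells_def)
    ultimately show "card (standard_tableaux D) * card (standard_tableaux (U - {x}))
      \<le> card (standard_tableaux (D \<union> U - {x}))" by simp
  qed
  \<comment> \<open>A maximal cell of \<open>U\<close> stays maximal in the union, since no cell of
    \<open>U\<close> precedes a cell of \<open>D\<close>.\<close>
  also have "\<dots> \<le> (\<Sum>x\<in>maximal_cells (D \<union> U). card (standard_tableaux (D \<union> U - {x})))"
    using Suc.prems by (intro sum_mono2) (auto simp: maximal_cells_def)
  also have "\<dots> = card (standard_tableaux (D \<union> U))"
    using Suc.prems ne by (intro card_standard_tableaux_rec[symmetric]) auto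
  finally show ?case .
qed

lemma card_standard_tableaux_stages:
  fixes st :: "nat \<times> nat \<Rightarrow> nat"
  assumes "finite S" "\<And>x y. x \<in> S \<Longrightarrow> y \<in> S \<Longrightarrow> precedes x y \<Longrightarrow> st x \<le> st y"
    and "\<And>x. x \<in> S \<Longrightarrow> st x < m"
  shows "(\<Prod>s<m. card (standard_tableaux {x\<in>S. st x = s})) \<le> card (standard_tableaux S)"
  using assms
proof (induction m arbitrary: S)
  case 0
  hence "S = {}" by auto
  then show ?case by (simp add: card_standard_tableaux_empty)
next
  case (Suc m)
  let ?D = "{x\<in>S. st x < m}" and ?U = "{x\<in>S. st x = m}"
  have "{x\<in>?D. st x = s} = {x\<in>S. st x = s}" if "s < m" for s using that by auto
  hence "(\<Prod>s<m. card (standard_tableaux {x\<in>S. st x = s})) =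
    (\<Prod>s<m. card (standard_tableaux {x\<in>?D. st x = s}))" by simp
  also have "\<dots> \<le> card (standard_tableaux ?D)"
    by (rule Suc.IH) (use Suc.prems in auto)
  finally have "(\<Prod>s<Suc m. card (standard_tableaux {x\<in>S. st x = s})) \<le>
    card (standard_tableaux ?D) * card (standard_tableaux ?U)" by simp
  also have "\<dots> \<le> card (standard_tableaux (?D \<union> ?U))"
  proof (rule card_standard_tableaux_Un)
    show "\<not> precedes x y" if "x \<in> ?U" "y \<in> ?D" for x y
      using Suc.prems(2)[of x y] that by auto
  qed (use Suc.prems(1) in auto)
  also have "?D \<union> ?U = S" using Suc.prems(3) by (force simp: less_Suc_eq)
  finally show ?case .
qed

section \<open>Entropy of multinomial coefficients\<close>

text \<open>Only the limit 0 needs an argument, because \<open>ln\<close> is not continuous there: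
  \<open>xlogx\<close> is squeezed between two functions that vanish at 0.\<close>

lemma tendsto_xlogx:
  fixes y :: "nat \<Rightarrow> real"
  assumes lim: "y \<longlonglongrightarrow> a" and nonneg: "\<And>n. y n \<ge> 0"
  shows "(\<lambda>n. xlogx (y n)) \<longlonglongrightarrow> xlogx a"
proof (cases "a = 0")
  case False
  then show ?thesis unfolding xlogx_def by (intro tendsto_intros lim)
next
  case True
  have lower: "2 * (y n - sqrt (y n)) \<le> xlogx (y n)" for n
  proof (cases "y n = 0")
    case False
    hence pos: "y n > 0" using nonneg[of n] by simp
    \<comment> \<open>This is \<open>ln z \<le> z - 1\<close> at \<open>z = 1 / sqrt (y n)\<close>.
      The square root leaves a positive power of \<open>y n\<close> after multiplication by
      \<open>y n\<close>.\<close>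
    have "ln (sqrt (y n)) \<ge> 1 - 1 / sqrt (y n)"
      using ln_add_one_self_le_self2[of "1 / sqrt (y n) - 1"] pos by (simp add: ln_div ln_sqrt)
    hence "y n * (2 * (1 - 1 / sqrt (y n))) \<le> y n * ln (y n)"
      using pos by (intro mult_left_mono) (auto simp: ln_sqrt)
    moreover have "y n * (1 / sqrt (y n)) = sqrt (y n)"
      using pos by (simp add: real_div_sqrt)
    ultimately show ?thesis by (simp add: xlogx_def right_diff_distrib mult.left_commute[of _ 2])
  qed (simp add: xlogx_def)
  have upper: "xlogx (y n) \<le> y n * y n" for n
  proof (cases "y n = 0")
    case False
    thus ?thesis using nonneg[of n] ln_le_minus_one[of "y n"]
      unfolding xlogx_def by (intro mult_left_mono) auto
  qed (simp add: xlogx_def)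
  have "(\<lambda>n. 2 * (y n - sqrt (y n))) \<longlonglongrightarrow> 2 * (a - sqrt a)" by (intro tendsto_intros lim)
  moreover have "(\<lambda>n. y n * y n) \<longlonglongrightarrow> a * a" by (intro tendsto_intros lim)
  ultimately have "(\<lambda>n. xlogx (y n)) \<longlonglongrightarrow> 0"
    using True
    by (intro tendsto_sandwich[OF always_eventually[OF allI[OF lower]]
          always_eventually[OF allI[OF upper]]]) simp_all
  thus ?thesis using True by (simp add: xlogx_def)
qed

text \<open>With the next lemma this is Stirling's formula up to a logarithmic error. The induction
  step amounts to \<open>m (ln (m + 1) - ln m) \<le> 1\<close>.\<close>

lemma ln_fact_ge: "xlogx (real m) - real m \<le> ln (fact m)"
proof (induction m)
  case 0
  then show ?case by (simp add: xlogx_def)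
next
  case (Suc m)
  have "real m * (ln (real m + 1) - ln (real m)) \<le> 1"
  proof (cases "m = 0")
    case False
    hence "ln (real m + 1) - ln (real m) = ln ((real m + 1) / real m)" by (simp add: ln_div)
    also have "(real m + 1) / real m = 1 + 1 / real m" using False by (simp add: add_divide_distrib)
    also have "ln (1 + 1 / real m) \<le> 1 / real m" by (intro ln_add_one_self_le_self) auto
    finally have "real m * (ln (real m + 1) - ln (real m)) \<le> real m * (1 / real m)"
      by (intro mult_left_mono) auto
    thus ?thesis using False by simp
  qed auto
  moreover have "ln (fact (Suc m) :: real) = ln (real m + 1) + ln (fact m)"
    by (simp add: ln_mult add.commute)
  ultimately show ?case using Suc by (simp add: xlogx_def algebra_simps)
qed

text \<open>The shift to \<open>m + 1\<close> lets the induction close: the step needs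
  \<open>(m + 2) (ln (m + 2) - ln (m + 1)) \<ge> 1\<close>.\<close>

lemma ln_fact_le: "ln (fact m) \<le> xlogx (real m + 1) - real m"
proof (induction m)
  case 0
  then show ?case by (simp add: xlogx_def)
next
  case (Suc m)
  have "ln ((real m + 1) / (real m + 2)) \<le> (real m + 1) / (real m + 2) - 1"
    by (intro ln_le_minus_one) auto
  hence "1 / (real m + 2) \<le> ln (real m + 2) - ln (real m + 1)"
    by (simp add: ln_div field_simps)
  hence "1 \<le> (real m + 2) * (ln (real m + 2) - ln (real m + 1))" by (simp add: field_simps)
  moreover have "ln (fact (Suc m) :: real) = ln (real m + 1) + ln (fact m)"
    by (simp add: ln_mult add.commute)
  ultimately show ?case using Suc by (simp add: xlogx_def algebra_simps)
qed

text \<open>Subtracting \<open>x ln n\<close> turns both Stirling bounds into functions of the ratio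
  \<open>x / n\<close>, up to a vanishing error.\<close>

lemma tendsto_ln_fact:
  fixes x :: "nat \<Rightarrow> nat"
  assumes lim: "(\<lambda>n. real (x n) / real n) \<longlonglongrightarrow> a"
  shows "(\<lambda>n. (ln (fact (x n)) - real (x n) * ln (real n)) / real n) \<longlonglongrightarrow> xlogx a - a"
proof -
  let ?l = "\<lambda>n. xlogx (real (x n) / real n) - real (x n) / real n"
  \<comment> \<open>The last term compensates for scaling \<open>x + 1\<close> instead of
    \<open>x\<close>, which subtracts \<open>ln n\<close> once too often.\<close>
  let ?u = "\<lambda>n. xlogx ((real (x n) + 1) / real n) - real (x n) / real n + ln (real n) / real n"
  have one: "(\<lambda>n. 1 / real n) \<longlonglongrightarrow> 0" by (simp add: lim_inverse_n' )
  have lnn: "(\<lambda>n. ln (real n) / real n) \<longlonglongrightarrow> 0" 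
    using filterlim_compose[OF ln_x_over_x_tendsto_0 filterlim_real_sequentially] by simp
  have "(\<lambda>n. (real (x n) + 1) / real n) \<longlonglongrightarrow> a"
    using tendsto_add[OF lim one] by (simp add: add_divide_distrib)
  hence U: "?u \<longlonglongrightarrow> xlogx a - a + 0"
    by (intro tendsto_add tendsto_diff tendsto_xlogx lim lnn) auto
  have L: "?l \<longlonglongrightarrow> xlogx a - a" by (intro tendsto_diff tendsto_xlogx lim) auto
  have scale: "xlogx (z / real n) = (xlogx z - z * ln (real n)) / real n" if "n > 0" "z \<ge> 0" for z n
    using that by (cases "z = 0") (auto simp: xlogx_def ln_div field_simps)
  show ?thesis
  proof (rule tendsto_sandwich[OF _ _ L])
    show "\<forall>\<^sub>F n in sequentially. ?l n \<le> (ln (fact (x n)) - real (x n) * ln (real n)) / real n"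
      using eventually_gt_at_top[of 0]
    proof eventually_elim
      case (elim n)
      have "?l n = (xlogx (real (x n)) - real (x n) - real (x n) * ln (real n)) / real n"
        using elim by (simp add: scale diff_divide_distrib)
      also have "\<dots> \<le> (ln (fact (x n)) - real (x n) * ln (real n)) / real n"
        using ln_fact_ge[of "x n"] by (intro divide_right_mono) auto
      finally show ?case .
    qed
    show "\<forall>\<^sub>F n in sequentially. (ln (fact (x n)) - real (x n) * ln (real n)) / real n \<le> ?u n"
      using eventually_gt_at_top[of 0]
    proof eventually_elim
      case (elim n)
      have "(ln (fact (x n)) - real (x n) * ln (real n)) / real n \<le>
        (xlogx (real (x n) + 1) - real (x n) - real (x n) * ln (real n)) / real n"
        using ln_fact_le[of "x n"] by (intro divide_right_mono) auto
      also have "\<dots> = ?u n"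
        using elim scale[of n "real (x n) + 1"]
        by (simp add: diff_divide_distrib distrib_right add_divide_distrib)
      finally show ?case .
    qed
    show "?u \<longlonglongrightarrow> xlogx a - a" using U by simp
  qed
qed

text \<open>The terms with \<open>ln n\<close> and the linear terms of Stirling's formula cancel,
  because the class sizes add up to the numerator; the entropy remains.\<close>

lemma tendsto_ln_multinomial:
  fixes x :: "'c \<Rightarrow> nat \<Rightarrow> nat"
  assumes "\<And>c. c \<in> C \<Longrightarrow> (\<lambda>n. real (x c n) / real n) \<longlonglongrightarrow> a c"
  shows "(\<lambda>n. (ln (fact (\<Sum>c\<in>C. x c n)) - (\<Sum>c\<in>C. ln (fact (x c n)))) / real n)
    \<longlonglongrightarrow> xlogx (\<Sum>c\<in>C. a c) - (\<Sum>c\<in>C. xlogx (a c))"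
proof -
  have "(\<lambda>n. real (\<Sum>c\<in>C. x c n) / real n) \<longlonglongrightarrow> (\<Sum>c\<in>C. a c)"
    using tendsto_sum[OF assms, of C] by (simp add: sum_divide_distrib)
  note lim = tendsto_ln_fact[OF this]
  have "(\<lambda>n. (ln (fact (\<Sum>c\<in>C. x c n)) - real (\<Sum>c\<in>C. x c n) * ln (real n)) / real n
       - (\<Sum>c\<in>C. (ln (fact (x c n)) - real (x c n) * ln (real n)) / real n))
    \<longlonglongrightarrow> (xlogx (\<Sum>c\<in>C. a c) - (\<Sum>c\<in>C. a c)) - (\<Sum>c\<in>C. xlogx (a c) - a c)"
    by (intro tendsto_diff[OF lim tendsto_sum] tendsto_ln_fact assms)
  thus ?thesis
    by (simp add: sum_subtractf sum_distrib_right diff_divide_distrib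
        flip: sum_divide_distrib)
qed

section \<open>Blocks of a segment\<close>

text \<open>
  The segment (a, b] is cut into L blocks numbered 0, ..., L - 1 of almost equal length. The
  formula is the rank of u in the segment, scaled by L / (b - a) and rounded down.
\<close>

definition block :: "nat \<Rightarrow> nat \<Rightarrow> nat \<Rightarrow> nat \<Rightarrow> nat" where
  "block L a b u = ((u - 1 - a) * L) div (b - a)"

lemma block_mono: "u \<le> v \<Longrightarrow> block L a b u \<le> block L a b v"
  unfolding block_def by (intro div_le_mono mult_right_mono) auto

text \<open>This is what makes the stages compatible with the column condition on consecutive arms.\<close>

lemma block_antimono:
  assumes "a' \<le> a" "b' \<le> b" "a < u" "u \<le> b'"
  shows "block L a b u \<le> block L a' b' u"
proof -
  let ?x = "u - 1 - a" and ?x' = "u - 1 - a'"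
  let ?q = "block L a b u"
  have pos: "0 < b - a" "0 < b' - a'" using assms by auto
  obtain d where d: "a = a' + d" using assms(1) le_iff_add by blast
  have x': "?x' = ?x + d" using assms d by auto
  \<comment> \<open>Moving the left end by \<open>d\<close> adds \<open>d\<close> to the rank and at
    most \<open>d\<close> to the length. As the relative position is at most 1, it does not
    decrease; \<open>cross\<close> states this without fractions.\<close>
  have "b' - a' \<le> (b - a) + d" using assms d by auto
  hence "?x * (b' - a') \<le> ?x * (b - a) + ?x * d" by (metis add_mult_distrib2 mult_le_mono2)
  also have "\<dots> \<le> ?x * (b - a) + (b - a) * d" using assms by (intro add_left_mono mult_right_mono) auto
  also have "\<dots> = ?x' * (b - a)" 
    by (simp only: x' add_mult_distrib mult.commute[of d])
  finally have cross: "?x * (b' - a') \<le> ?x' * (b - a)" .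
  have "?q * (b - a) \<le> ?x * L" by (simp add: block_def)
  hence "?q * (b - a) * (b' - a') \<le> ?x * L * (b' - a')" by (rule mult_le_mono1)
  also have "\<dots> = L * (?x * (b' - a'))" by (simp only: ac_simps)
  also have "\<dots> \<le> L * (?x' * (b - a))" using cross by (rule mult_le_mono2)
  finally have "(b - a) * (?q * (b' - a')) \<le> (b - a) * (?x' * L)" by (simp only: ac_simps)
  hence "?q * (b' - a') \<le> ?x' * L" using pos(1) by (simp only: mult_le_cancel1)
  thus ?thesis unfolding block_def[of L a' b' u] using pos(2) by (simp add: less_eq_div_iff_mult_less_eq)
qed

lemma block_less:
  assumes "a < u" "u \<le> b" "L > 0"
  shows "block L a b u < L"
  using assms unfolding block_def
  by (subst div_less_iff_less_mult) (auto simp: mult.commute[of L])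

text \<open>Counted from 0, the ranks in block \<open>t\<close> form an interval between consecutive
  rounded multiples of \<open>(b - a) / L\<close>, so rounding changes its length by at most
  1.\<close>

lemma card_block:
  assumes "t < L"
  shows "\<bar>real (card {u. a < u \<and> u \<le> b \<and> block L a b u = t}) - real (b - a) / real L\<bar> \<le> 1"
proof (cases "a < b")
  case False
  hence "{u. a < u \<and> u \<le> b \<and> block L a b u = t} = {}" by auto
  thus ?thesis using False by (simp only: card.empty) simp
next
  case True
  let ?A = "b - a"
  \<comment> \<open>This is \<open>t (b - a) / L\<close> rounded up, the first rank of block
    \<open>t\<close>.\<close>
  define q where "q t = (t * ?A + L - 1) div L" for t
  have A: "?A > 0" and L: "L > 0" using True assms by auto
  have q: "q t \<le> x \<longleftrightarrow> t * ?A \<le> x * L" for t x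
  proof -
    have "q t \<le> x \<longleftrightarrow> q t < Suc x" by auto
    also have "\<dots> \<longleftrightarrow> t * ?A + L - 1 < Suc x * L" unfolding q_def using L by (rule div_less_iff_less_mult)
    also have "\<dots> \<longleftrightarrow> t * ?A \<le> x * L" using L by auto
    finally show ?thesis .
  qed
  have blk: "(x * L) div ?A = t \<longleftrightarrow> q t \<le> x \<and> x < q (Suc t)" for x
  proof -
    have "(x * L) div ?A = t \<longleftrightarrow> t \<le> (x * L) div ?A \<and> (x * L) div ?A < Suc t" by auto
    also have "\<dots> \<longleftrightarrow> t * ?A \<le> x * L \<and> x * L < Suc t * ?A"
      using A by (simp only: less_eq_div_iff_mult_less_eq div_less_iff_less_mult)
    also have "\<dots> \<longleftrightarrow> q t \<le> x \<and> x < q (Suc t)" using q[of t x] q[of "Suc t" x] by (simp only: not_le[symmetric])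
    finally show ?thesis .
  qed
  have qA: "q (Suc t) \<le> ?A"
    unfolding q using assms mult_le_mono1[of "Suc t" L ?A] by (simp add: mult.commute)
  have "{u. a < u \<and> u \<le> b \<and> block L a b u = t} = (\<lambda>x. x + a + 1) ` {q t..<q (Suc t)}"
  proof (intro equalityI subsetI)
    fix u assume "u \<in> {u. a < u \<and> u \<le> b \<and> block L a b u = t}"
    hence u: "a < u" "((u - 1 - a) * L) div ?A = t" by (auto simp: block_def)
    have "u - 1 - a \<in> {q t..<q (Suc t)}" using u(2) blk by simp
    moreover have "u = u - 1 - a + a + 1" using u(1) by simp
    ultimately show "u \<in> (\<lambda>x. x + a + 1) ` {q t..<q (Suc t)}" by (rule rev_image_eqI)
  next
    fix u assume "u \<in> (\<lambda>x. x + a + 1) ` {q t..<q (Suc t)}"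
    then obtain x where x: "u = x + a + 1" "q t \<le> x" "x < q (Suc t)" by auto
    have "(x * L) div ?A = t" using blk x by simp
    thus "u \<in> {u. a < u \<and> u \<le> b \<and> block L a b u = t}" using x qA by (auto simp: block_def)
  qed
  hence "card {u. a < u \<and> u \<le> b \<and> block L a b u = t} = q (Suc t) - q t"
    by (simp only:) (subst card_image, auto simp: inj_on_def)
  moreover have "q t \<le> q (Suc t)" unfolding q_def by (intro div_le_mono diff_le_mono add_right_mono mult_right_mono) auto
  moreover have lo: "t * ?A \<le> q t * L" for t using q[of t "q t"] by simp
  moreover have hi: "q t * L \<le> t * ?A + L" for t
  proof -
    have "q t * L \<le> t * ?A + L - 1" unfolding q_def by simp
    thus ?thesis by simp
  qed
  have "real (t * ?A) \<le> real (q t * L)" "real (q t * L) \<le> real (t * ?A + L)"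
    "real (Suc t * ?A) \<le> real (q (Suc t) * L)" "real (q (Suc t) * L) \<le> real (Suc t * ?A + L)"
    using lo[of t] hi[of t] lo[of "Suc t"] hi[of "Suc t"] by (simp_all only: of_nat_le_iff)
  \<comment> \<open>Each of the two end points, times \<open>L\<close>, exceeds its exact value by
    at least 0 and at most \<open>L\<close>, so their difference is off by at most
    \<open>L\<close>.\<close>
  hence "\<bar>(real (q (Suc t)) - real (q t)) * real L - real ?A\<bar> \<le> real L"
    by (simp only: of_nat_mult of_nat_add of_nat_Suc distrib_right left_diff_distrib abs_le_iff) linarith
  hence "\<bar>((real (q (Suc t)) - real (q t)) * real L - real ?A) / real L\<bar> \<le> 1"
    using L by (simp add: abs_divide)
  hence "\<bar>real (q (Suc t)) - real (q t) - real ?A / real L\<bar> \<le> 1"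
    using L by (simp add: diff_divide_distrib)
  ultimately show ?thesis by (simp add: of_nat_diff)
qed

section \<open>Diagrams and Frobenius coordinates\<close>

lemma part_antimono:
  assumes "is_partition p" "1 \<le> i" "i \<le> j"
  shows "part p j \<le> part p i"
proof (cases "i = j \<or> j > length p")
  case False
  hence "p ! (i - 1) \<ge> p ! (j - 1)"
    using assms unfolding is_partition_def by (intro sorted_wrt_nth_less[of "(\<ge>)" p]) auto
  thus ?thesis using assms False by (simp add: part_def)
qed (auto simp: part_def)

lemma in_diagram_iff: "(i, j) \<in> diagram p \<longleftrightarrow> 1 \<le> i \<and> 1 \<le> j \<and> j \<le> part p i"
  by (simp add: diagram_def)

lemma diagram_downward:
  assumes "is_partition p" "(i, j) \<in> diagram p" "1 \<le> i'" "i' \<le> i" "1 \<le> j'" "j' \<le> j"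
  shows "(i', j') \<in> diagram p"
  using assms part_antimono[of p i' i] by (auto simp: in_diagram_iff)

lemma downward_closed_eq_atLeastAtMost:
  fixes A :: "nat set"
  assumes "finite A" "0 \<notin> A" "\<And>i j. j \<in> A \<Longrightarrow> 1 \<le> i \<Longrightarrow> i \<le> j \<Longrightarrow> i \<in> A"
  shows "A = {1..card A}"
proof (cases "A = {}")
  case False
  have "A = {1..Max A}"
  proof (intro equalityI subsetI)
    fix x assume "x \<in> A"
    thus "x \<in> {1..Max A}" using assms(1,2) by (cases x) auto
  next
    fix x assume "x \<in> {1..Max A}"
    thus "x \<in> A" using assms(3)[of "Max A" x] Max_in[OF assms(1) False] by auto
  qed
  thus ?thesis by (metis card_atLeastAtMost diff_Suc_1)
qed auto

lemma finite_diagram_column: "finite {i. (i, j) \<in> diagram p}"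
  by (rule finite_subset[of _ "{1..length p}"]) (auto simp: in_diagram_iff part_def split: if_splits)

text \<open>Columns of a diagram are initial segments. This transposed description lets legs be
  treated like arms.\<close>

lemma in_diagram_iff_conj:
  assumes "is_partition p"
  shows "(i, j) \<in> diagram p \<longleftrightarrow> 1 \<le> i \<and> 1 \<le> j \<and> i \<le> conj_part p j"
proof (cases "1 \<le> j")
  case True
  have "{i. (i, j) \<in> diagram p} = {1..conj_part p j}"
    unfolding conj_part_def
  proof (rule downward_closed_eq_atLeastAtMost[OF finite_diagram_column])
    show "i \<in> {i. (i, j) \<in> diagram p}" if "l \<in> {i. (i, j) \<in> diagram p}" "1 \<le> i" "i \<le> l" for i l
      using diagram_downward[OF assms, of l j i j] that True by simp
  qed (simp add: in_diagram_iff)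
  thus ?thesis using True by (metis atLeastAtMost_iff mem_Collect_eq)
qed (simp add: in_diagram_iff)

lemma conj_part_antimono:
  assumes "is_partition p" "1 \<le> j" "j \<le> j'"
  shows "conj_part p j' \<le> conj_part p j"
  unfolding conj_part_def
  by (intro card_mono finite_diagram_column) (use assms in \<open>auto simp: in_diagram_iff\<close>)

text \<open>\<open>GREATEST\<close> is meaningful only for a bounded predicate; the bound comes from
  the cell \<open>(d, 1)\<close>, which forces at least \<open>d\<close> rows.\<close>

lemma le_durfee:
  assumes "{1..d} \<times> {1..d} \<subseteq> diagram p"
  shows "d \<le> durfee p"
proof -
  let ?P = "\<lambda>d. {1..d} \<times> {1..d} \<subseteq> diagram p"
  have bound: "\<forall>d. ?P d \<longrightarrow> d \<le> length p"
  proof (intro allI impI)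
    fix d assume P: "?P d"
    show "d \<le> length p"
    proof (cases "d = 0")
      case False
      hence "(d, 1) \<in> {1..d} \<times> {1..d}" by auto
      hence "(d, 1) \<in> diagram p" using P by blast
      thus ?thesis by (auto simp: in_diagram_iff part_def split: if_splits)
    qed simp
  qed
  thus ?thesis
    unfolding durfee_def using assms by (intro Greatest_le_nat) auto
qed

lemma diagonal_not_in_diagram:
  assumes "is_partition p" "durfee p < d"
  shows "(d, d) \<notin> diagram p"
proof
  assume "(d, d) \<in> diagram p"
  hence "{1..d} \<times> {1..d} \<subseteq> diagram p" using diagram_downward[OF assms(1), of d d] by auto
  thus False using le_durfee[of d p] assms(2) by simp
qed

text \<open>Up to the Durfee size the two differ by \<open>i\<close>. Beyond it the coordinate is 0
  by convention, while the row is no longer than the Durfee square. The bounded error disappears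
  after division by \<open>n\<close>.\<close>

lemma frobenius_arm_bounds:
  assumes "is_partition p" "durfee p \<le> k" "1 \<le> i" "i \<le> k"
  shows "frobenius_arm p i \<le> part p i" "part p i \<le> frobenius_arm p i + k"
proof -
  show "frobenius_arm p i \<le> part p i" by (simp add: frobenius_arm_def)
  show "part p i \<le> frobenius_arm p i + k"
  proof (cases "i \<le> durfee p")
    case False
    have "part p i \<le> durfee p"
    proof (rule ccontr)
      assume "\<not> part p i \<le> durfee p"
      hence "(i, Suc (durfee p)) \<in> diagram p" using assms by (simp add: in_diagram_iff)
      hence "(Suc (durfee p), Suc (durfee p)) \<in> diagram p"
        by (rule diagram_downward[OF assms(1)]) (use False in auto)
      thus False using diagonal_not_in_diagram[OF assms(1)] by auto
    qed
    thus ?thesis using assms by simp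
  qed (use assms in \<open>simp add: frobenius_arm_def\<close>)
qed

lemma frobenius_leg_bounds:
  assumes "is_partition p" "durfee p \<le> k" "1 \<le> j" "j \<le> k"
  shows "frobenius_leg p j \<le> conj_part p j" "conj_part p j \<le> frobenius_leg p j + k"
proof -
  show "frobenius_leg p j \<le> conj_part p j" by (simp add: frobenius_leg_def)
  show "conj_part p j \<le> frobenius_leg p j + k"
  proof (cases "j \<le> durfee p")
    case False
    have "conj_part p j \<le> durfee p"
    proof (rule ccontr)
      assume "\<not> conj_part p j \<le> durfee p"
      hence "(Suc (durfee p), j) \<in> diagram p" using assms by (simp add: in_diagram_iff_conj)
      hence "(Suc (durfee p), Suc (durfee p)) \<in> diagram p"
        by (rule diagram_downward[OF assms(1)]) (use False in auto)
      thus False using diagonal_not_in_diagram[OF assms(1)] by auto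
    qed
    thus ?thesis using assms by simp
  qed (use assms in \<open>simp add: frobenius_leg_def\<close>)
qed

section \<open>Skew shapes with bounded Durfee square\<close>

text \<open>Colours up to \<open>k\<close> are rows, the corner included; colours
  \<open>k + 1\<close> to \<open>2 * k\<close> are the columns below row \<open>k\<close>.\<close>

definition color :: "nat \<Rightarrow> nat \<times> nat \<Rightarrow> nat" where
  "color k = (\<lambda>(i, j). if i \<le> k then i else k + j)"

text \<open>The maxima with \<open>k\<close> remove the corner from each segment. Since rows and
  columns start at 1, every cell outside the corner has positive stage.\<close>

definition stage :: "nat \<Rightarrow> nat \<Rightarrow> nat list \<Rightarrow> nat list \<Rightarrow> nat \<times> nat \<Rightarrow> nat" where
  "stage L k lam mu = (\<lambda>(i, j).
     if i \<le> k \<and> j \<le> k then 0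
     else if i \<le> k then i + block L (max k (part mu i)) (max k (part lam i)) j
     else j + block L (max k (conj_part mu j)) (max k (conj_part lam j)) i)"

text \<open>For rows the corner cells are left out, although \<open>color\<close> counts them with
  the row.\<close>

definition limb_length :: "nat \<Rightarrow> nat list \<Rightarrow> nat list \<Rightarrow> nat \<Rightarrow> nat" where
  "limb_length k lam mu c =
     (if c \<le> k then max k (part lam c) - max k (part mu c)
      else max k (conj_part lam (c - k)) - max k (conj_part mu (c - k)))"

definition limb_coordinate :: "nat \<Rightarrow> nat list \<Rightarrow> nat \<Rightarrow> nat" where
  "limb_coordinate k p c = (if c \<le> k then frobenius_arm p c else frobenius_leg p (c - k))"

locale thin_skew_shape =
  fixes lam mu :: "nat list" and k :: nat
  assumes skew: "is_skew_shape lam mu"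
    and durfee_le: "durfee lam \<le> k"
    and durfee_le': "durfee mu \<le> k"
begin

abbreviation S where "S \<equiv> skew_diagram lam mu"

lemma partitions: "is_partition lam" "is_partition mu"
  and subset: "diagram mu \<subseteq> diagram lam"
  using skew by (auto simp: is_skew_shape_def)

lemma in_S_iff: "(i, j) \<in> S \<longleftrightarrow> 1 \<le> i \<and> 1 \<le> j \<and> part mu i < j \<and> j \<le> part lam i"
  by (auto simp: skew_diagram_def in_diagram_iff)

lemma in_S_iff_conj: "(i, j) \<in> S \<longleftrightarrow> 1 \<le> i \<and> 1 \<le> j \<and> conj_part mu j < i \<and> i \<le> conj_part lam j"
  by (auto simp: skew_diagram_def in_diagram_iff_conj partitions)

text \<open>A cell beyond \<open>k\<close> in both directions would put the diagonal cell
  \<open>(k + 1, k + 1)\<close> into \<open>lam\<close>.\<close>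

lemma S_thin: "(i, j) \<in> S \<Longrightarrow> i \<le> k \<or> j \<le> k"
proof (rule ccontr)
  assume ij: "(i, j) \<in> S" and "\<not> (i \<le> k \<or> j \<le> k)"
  hence "(Suc k, Suc k) \<in> diagram lam"
    using diagram_downward[OF partitions(1), of i j "Suc k" "Suc k"] by (auto simp: skew_diagram_def)
  thus False using diagonal_not_in_diagram[OF partitions(1), of "Suc k"] durfee_le by auto
qed

lemma finite_S: "finite S"
proof (rule finite_subset)
  have "i \<le> length lam \<and> j \<le> part lam 1" if "(i, j) \<in> S" for i j
    using that part_antimono[OF partitions(1), of 1 i]
    by (auto simp: in_S_iff) (auto simp: part_def split: if_splits)
  thus "S \<subseteq> {..length lam} \<times> {..part lam 1}" by auto
qed simp

section \<open>Sizes of the colour classes and the upper bound\<close>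

lemma part_le: "1 \<le> i \<Longrightarrow> part mu i \<le> part lam i"
  using subset in_diagram_iff[of i "part mu i" mu] in_diagram_iff[of i "part mu i" lam]
  by (cases "part mu i") auto

lemma conj_part_le: "conj_part mu j \<le> conj_part lam j"
  unfolding conj_part_def using subset by (intro card_mono finite_diagram_column) auto

lemma color_in: "x \<in> S \<Longrightarrow> color k x \<in> {1..2 * k}"
  using S_thin[of "fst x" "snd x"] by (cases x) (auto simp: color_def in_S_iff)

lemma color_row: "1 \<le> i \<Longrightarrow> i \<le> k \<Longrightarrow> {y\<in>S. color k y = i} = {i} \<times> {part mu i<..part lam i}"
  by (auto simp: color_def in_S_iff split: if_splits)

lemma color_column:
  assumes "1 \<le> j" "j \<le> k"
  shows "{y\<in>S. color k y = k + j} =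
    {max k (conj_part mu j)<..max k (conj_part lam j)} \<times> {j}"
  using assms by (auto simp: color_def in_S_iff_conj split: if_splits)

lemma card_color_row:
  "1 \<le> i \<Longrightarrow> i \<le> k \<Longrightarrow> card {y\<in>S. color k y = i} = part lam i - part mu i"
  by (subst color_row) (auto simp: card_cartesian_product)

lemma card_color_column:
  "1 \<le> j \<Longrightarrow> j \<le> k \<Longrightarrow> card {y\<in>S. color k y = k + j} =
    max k (conj_part lam j) - max k (conj_part mu j)"
  by (subst color_column) (auto simp: card_cartesian_product)

text \<open>Each colour class lies in one row or one column, hence is a chain. The numerator is
  written as a sum of class sizes to match \<open>tendsto_ln_multinomial\<close>.\<close>

lemma ln_num_SYT_le:
  "ln (real (num_SYT lam mu)) \<le>
    ln (fact (\<Sum>c\<in>{1..2 * k}. card {y\<in>S. color k y = c})) -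
    (\<Sum>c\<in>{1..2 * k}. ln (fact (card {y\<in>S. color k y = c})))"
proof -
  have "num_SYT lam mu * (\<Prod>c\<in>{1..2 * k}. fact (card {y\<in>S. color k y = c})) \<le> fact (card S)"
    unfolding num_SYT_def
  proof (rule card_standard_tableaux_le_multinomial[OF finite_S])
    show "precedes x y \<or> precedes y x" if "x \<in> S" "y \<in> S" "color k x = color k y" "x \<noteq> y" for x y
      using that S_thin[of "fst x" "snd x"] S_thin[of "fst y" "snd y"]
      by (cases x; cases y) (auto simp: color_def precedes_def in_S_iff split: if_splits)
  qed (use color_in in auto)
  hence "real (num_SYT lam mu * (\<Prod>c\<in>{1..2 * k}. fact (card {y\<in>S. color k y = c}))) \<le>
    real (fact (card S))" by (simp only: of_nat_le_iff)
  moreover have "num_SYT lam mu > 0"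
    using card_standard_tableaux_pos[OF finite_S] by (simp add: num_SYT_def)
  ultimately have "ln (real (num_SYT lam mu) * (\<Prod>c\<in>{1..2 * k}. fact (card {y\<in>S. color k y = c})))
    \<le> ln (fact (card S))" by (subst ln_le_cancel_iff) (auto intro!: mult_pos_pos prod_pos)
  thus ?thesis using \<open>num_SYT lam mu > 0\<close>
    by (simp only: sum_card_color_classes[OF finite_S finite_atLeastAtMost color_in])
      (simp add: ln_mult ln_prod prod_pos)
qed

text \<open>Two cells of a row may start in the corner, at stage 0, lie in the same arm, or lie in
  two different legs. Only in the last case do the colours outside the corner differ, and there the
  delay makes the stages differ too.\<close>

lemma stage_row:
  assumes "(i, j) \<in> S" "(i, j') \<in> S" "j < j'"
  shows "stage L k lam mu (i, j) \<le> stage L k lam mu (i, j')"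
    and "0 < stage L k lam mu (i, j) \<Longrightarrow> stage L k lam mu (i, j) = stage L k lam mu (i, j')
      \<Longrightarrow> color k (i, j) = color k (i, j')"
proof -
  consider "i \<le> k" "j \<le> k" | "i \<le> k" "k < j" | "k < i" "j' \<le> k"
    using S_thin[OF assms(2)] by linarith
  hence "stage L k lam mu (i, j) \<le> stage L k lam mu (i, j') \<and>
    (0 < stage L k lam mu (i, j) \<longrightarrow> stage L k lam mu (i, j) = stage L k lam mu (i, j')
      \<longrightarrow> color k (i, j) = color k (i, j'))"
  proof cases
    case 1
    thus ?thesis by (simp add: stage_def)
  next
    case 2
    thus ?thesis using assms(3) by (simp add: stage_def color_def block_mono)
  next
    case 3
    \<comment> \<open>Further right both ends of the leg move up or stay, so the block number does
      not drop, while the added column index strictly grows.\<close>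
    have "block L (max k (conj_part mu j)) (max k (conj_part lam j)) i \<le>
      block L (max k (conj_part mu j')) (max k (conj_part lam j')) i"
      using assms 3 conj_part_antimono[OF partitions(1), of j j'] conj_part_antimono[OF partitions(2), of j j']
      by (intro block_antimono) (auto simp: in_S_iff_conj)
    thus ?thesis using 3 assms(3) by (simp add: stage_def)
  qed
  thus "stage L k lam mu (i, j) \<le> stage L k lam mu (i, j')"
    and "0 < stage L k lam mu (i, j) \<Longrightarrow> stage L k lam mu (i, j) = stage L k lam mu (i, j')
      \<Longrightarrow> color k (i, j) = color k (i, j')" by auto
qed

text \<open>The transposed argument. Positivity of the stage excludes the corner, where cells of one
  column have different colours.\<close>

lemma stage_column:
  assumes "(i, j) \<in> S" "(i', j) \<in> S" "i < i'"
  shows "stage L k lam mu (i, j) \<le> stage L k lam mu (i', j)"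
    and "0 < stage L k lam mu (i, j) \<Longrightarrow> stage L k lam mu (i, j) = stage L k lam mu (i', j)
      \<Longrightarrow> color k (i, j) = color k (i', j)"
proof -
  consider "i \<le> k" "j \<le> k" | "k < i" "j \<le> k" | "k < j" "i' \<le> k"
    using S_thin[OF assms(1)] S_thin[OF assms(2)] by linarith
  hence "stage L k lam mu (i, j) \<le> stage L k lam mu (i', j) \<and>
    (0 < stage L k lam mu (i, j) \<longrightarrow> stage L k lam mu (i, j) = stage L k lam mu (i', j)
      \<longrightarrow> color k (i, j) = color k (i', j))"
  proof cases
    case 1
    thus ?thesis by (simp add: stage_def)
  next
    case 2
    thus ?thesis using assms(3) by (simp add: stage_def color_def block_mono)
  next
    case 3
    have "block L (max k (part mu i)) (max k (part lam i)) j \<le>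
      block L (max k (part mu i')) (max k (part lam i')) j"
      using assms 3 part_antimono[OF partitions(1), of i i'] part_antimono[OF partitions(2), of i i']
      by (intro block_antimono) (auto simp: in_S_iff)
    thus ?thesis using 3 assms(3) by (simp add: stage_def)
  qed
  thus "stage L k lam mu (i, j) \<le> stage L k lam mu (i', j)"
    and "0 < stage L k lam mu (i, j) \<Longrightarrow> stage L k lam mu (i, j) = stage L k lam mu (i', j)
      \<Longrightarrow> color k (i, j) = color k (i', j)" by auto
qed

text \<open>The first fact permits filling stage after stage; the second is the colour hypothesis of
  the lower multinomial bound within a positive stage.\<close>

lemma stage_precedes:
  assumes "x \<in> S" "y \<in> S" "precedes x y"
  shows "stage L k lam mu x \<le> stage L k lam mu y"
    and "0 < stage L k lam mu x \<Longrightarrow> stage L k lam mu x = stage L k lam mu y \<Longrightarrow> color k x = color k y"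
  using assms stage_row[of "fst x" "snd x" "snd y" L] stage_column[of "fst x" "snd x" "fst y" L]
  by (cases x; cases y; force simp: precedes_def)+

lemma stage_less:
  assumes "L > 0" "x \<in> S"
  shows "stage L k lam mu x < k + L"
proof -
  obtain i j where x: "x = (i, j)" by force
  consider "i \<le> k" "j \<le> k" | "i \<le> k" "k < j" | "k < i" "j \<le> k"
    using S_thin assms(2) unfolding x by force
  thus ?thesis
  proof cases
    case 1
    thus ?thesis using assms(1) by (simp add: x stage_def)
  next
    case 2
    have "block L (max k (part mu i)) (max k (part lam i)) j < L"
      using assms 2 by (intro block_less) (auto simp: x in_S_iff)
    thus ?thesis using 2 by (simp add: x stage_def)
  next
    case 3
    have "block L (max k (conj_part mu j)) (max k (conj_part lam j)) i < L"
      using assms 3 by (intro block_less) (auto simp: x in_S_iff_conj)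
    thus ?thesis using 3 by (simp add: x stage_def)
  qed
qed

text \<open>For \<open>k < s\<close> the difference of \<open>s\<close> and the delay does not
  truncate, and for \<open>s \<le> L\<close> it is below \<open>L\<close> because delays are at
  least 1. So stage \<open>s\<close> meets each limb in exactly one of its \<open>L\<close>
  blocks.\<close>

lemma card_stage_color:
  assumes "k < s" "s \<le> L" "c \<in> {1..2 * k}"
  shows "\<bar>real (card {y\<in>{y\<in>S. stage L k lam mu y = s}. color k y = c}) -
    real (limb_length k lam mu c) / real L\<bar> \<le> 1"
proof (cases "c \<le> k")
  case True
  let ?a = "max k (part mu c)" and ?b = "max k (part lam c)"
  have "{y\<in>{y\<in>S. stage L k lam mu y = s}. color k y = c} =
    {c} \<times> {u. ?a < u \<and> u \<le> ?b \<and> block L ?a ?b u = s - c}"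
    using assms True by (auto simp: color_def stage_def in_S_iff split: if_splits)
  moreover have "s - c < L" using assms True by auto
  ultimately show ?thesis
    using card_block[of "s - c" L ?a ?b] True by (simp add: card_cartesian_product limb_length_def)
next
  case False
  then obtain j where j: "c = k + j" "1 \<le> j" "j \<le> k"
    using assms(3) by (intro that[of "c - k"]) auto
  let ?a = "max k (conj_part mu j)" and ?b = "max k (conj_part lam j)"
  have "{y\<in>{y\<in>S. stage L k lam mu y = s}. color k y = c} =
    {u. ?a < u \<and> u \<le> ?b \<and> block L ?a ?b u = s - j} \<times> {j}"
    using assms(1) j by (auto simp: color_def stage_def in_S_iff_conj split: if_splits)
  hence "card {y\<in>{y\<in>S. stage L k lam mu y = s}. color k y = c} =
    card {u. ?a < u \<and> u \<le> ?b \<and> block L ?a ?b u = s - j}"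
    by (simp only: card_cartesian_product card_1_singleton_iff) simp
  moreover have "s - j < L" using assms j by auto
  moreover have "limb_length k lam mu c = ?b - ?a" using j by (simp add: limb_length_def)
  ultimately show ?thesis using card_block[of "s - j" L ?a ?b] by (simp only:)
qed

text \<open>
  Only the stages in (k, L] are kept: they contain one block of every arm and every leg.
\<close>

lemma ln_num_SYT_ge:
  assumes "k < L"
  shows "(\<Sum>s\<in>{k<..L}.
      ln (fact (\<Sum>c\<in>{1..2 * k}. card {y\<in>{y\<in>S. stage L k lam mu y = s}. color k y = c})) -
      (\<Sum>c\<in>{1..2 * k}. ln (fact (card {y\<in>{y\<in>S. stage L k lam mu y = s}. color k y = c}))))
    \<le> ln (real (num_SYT lam mu))"
proof -
  let ?U = "\<lambda>s. {y\<in>S. stage L k lam mu y = s}"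
  let ?e = "\<lambda>s. card (standard_tableaux (?U s))"
  have e_pos: "?e s \<ge> 1" for s
    by (rule card_standard_tableaux_pos, rule finite_subset[OF _ finite_S]) blast
  have stage_bound: "ln (fact (\<Sum>c\<in>{1..2 * k}. card {y\<in>?U s. color k y = c})) -
      (\<Sum>c\<in>{1..2 * k}. ln (fact (card {y\<in>?U s. color k y = c}))) \<le> ln (real (?e s))"
    if "s > 0" for s
  proof -
    have "fact (card (?U s)) \<le> ?e s * (\<Prod>c\<in>{1..2 * k}. fact (card {y\<in>?U s. color k y = c}))"
    proof (rule multinomial_le_card_standard_tableaux)
      show "color k x = color k y" if "x \<in> ?U s" "y \<in> ?U s" "precedes x y" for x y
        by (rule stage_precedes(2)[of x y L]) (use that \<open>s > 0\<close> in simp_all)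
    qed (use finite_S color_in in auto)
    hence "real (fact (card (?U s))) \<le>
      real (?e s * (\<Prod>c\<in>{1..2 * k}. fact (card {y\<in>?U s. color k y = c})))"
      by (simp only: of_nat_le_iff)
    moreover have "?e s > 0" using e_pos[of s] by simp
    ultimately have "ln (fact (card (?U s))) \<le>
      ln (real (?e s) * (\<Prod>c\<in>{1..2 * k}. fact (card {y\<in>?U s. color k y = c})))"
      by (subst ln_le_cancel_iff) (auto intro!: mult_pos_pos prod_pos)
    moreover have "(\<Sum>c\<in>{1..2 * k}. card {y\<in>?U s. color k y = c}) = card (?U s)"
      by (rule sum_card_color_classes) (use finite_S color_in in auto)
    ultimately show ?thesis using \<open>?e s > 0\<close>
      by (simp add: ln_mult ln_prod prod_pos)
  qed
  have "(\<Prod>s<k + L. ?e s) \<le> num_SYT lam mu"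
    unfolding num_SYT_def
    by (rule card_standard_tableaux_stages[OF finite_S])
      (use assms stage_less[of L] in \<open>auto intro: stage_precedes(1)\<close>)
  hence le: "real (\<Prod>s<k + L. ?e s) \<le> real (num_SYT lam mu)" by (simp only: of_nat_le_iff)
  have pos: "real (\<Prod>s<k + L. ?e s) > 0"
    unfolding of_nat_prod using e_pos by (intro prod_pos) (simp add: Suc_le_eq)
  have "(\<Sum>s\<in>{k<..L}. ln (fact (\<Sum>c\<in>{1..2 * k}. card {y\<in>?U s. color k y = c})) -
      (\<Sum>c\<in>{1..2 * k}. ln (fact (card {y\<in>?U s. color k y = c}))))
      \<le> (\<Sum>s\<in>{k<..L}. ln (real (?e s)))"
    by (intro sum_mono stage_bound) auto
  \<comment> \<open>The added terms are logarithms of numbers at least 1. The \<open>Suc\<close>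
    keeps the index \<open>L\<close> in range when \<open>k = 0\<close>; the extra stage
    \<open>k + L\<close> is empty and contributes 0.\<close>
  also have "\<dots> \<le> (\<Sum>s<Suc (k + L). ln (real (?e s)))"
    using e_pos by (intro sum_mono2) auto
  also have "\<dots> = (\<Sum>s<k + L. ln (real (?e s)))"
  proof -
    have "?U (k + L) = {}" using stage_less[of L] assms by force
    hence "?e (k + L) = 1" by (simp only: card_standard_tableaux_empty)
    thus ?thesis by simp
  qed
  also have "\<dots> = ln (real (\<Prod>s<k + L. ?e s))"
    unfolding of_nat_prod using e_pos by (subst ln_prod) (auto simp: Suc_le_eq)
  also have "\<dots> \<le> ln (real (num_SYT lam mu))"
    using le pos by simp
  finally show ?thesis .
qed

lemma limb_length_approx:
  assumes "c \<in> {1..2 * k}"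
  shows "\<bar>real (limb_length k lam mu c) -
      (real (limb_coordinate k lam c) - real (limb_coordinate k mu c))\<bar> \<le> real (2 * k)"
    and "\<bar>real (card {y\<in>S. color k y = c}) -
      (real (limb_coordinate k lam c) - real (limb_coordinate k mu c))\<bar> \<le> real (2 * k)"
proof -
  \<comment> \<open>Here \<open>x\<close> and \<open>y\<close> are row or column lengths,
    \<open>a\<close> and \<open>b\<close> the corresponding Frobenius coordinates; the two estimates
    are for lengths without and with the corner.\<close>
  have *: "\<bar>real (max k x - max k y) - (real a - real b)\<bar> \<le> real (2 * k) \<and>
      \<bar>real (x - y) - (real a - real b)\<bar> \<le> real (2 * k)"
    if "a \<le> x" "x \<le> a + k" "b \<le> y" "y \<le> b + k" "y \<le> x" for x y a b :: nat
    using that by (auto simp: max_def abs_le_iff of_nat_diff)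
  have "\<bar>real (limb_length k lam mu c) -
      (real (limb_coordinate k lam c) - real (limb_coordinate k mu c))\<bar> \<le> real (2 * k) \<and>
    \<bar>real (card {y\<in>S. color k y = c}) -
      (real (limb_coordinate k lam c) - real (limb_coordinate k mu c))\<bar> \<le> real (2 * k)"
  proof (cases "c \<le> k")
    case True
    hence c: "1 \<le> c" "c \<le> k" using assms by auto
    show ?thesis
      using *[OF frobenius_arm_bounds[OF partitions(1) durfee_le c]
          frobenius_arm_bounds[OF partitions(2) durfee_le' c] part_le[OF c(1)]] card_color_row[OF c] c
      by (simp add: limb_length_def limb_coordinate_def)
  next
    case False
    then obtain j where cj: "c = k + j" and j: "1 \<le> j" "j \<le> k"
      using assms by (intro that[of "c - k"]) auto
    show ?thesis
      using *[OF frobenius_leg_bounds[OF partitions(1) durfee_le j]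
          frobenius_leg_bounds[OF partitions(2) durfee_le' j] conj_part_le] card_color_column[OF j] j
      unfolding cj by (simp add: limb_length_def limb_coordinate_def)
  qed
  thus "\<bar>real (limb_length k lam mu c) -
      (real (limb_coordinate k lam c) - real (limb_coordinate k mu c))\<bar> \<le> real (2 * k)"
    and "\<bar>real (card {y\<in>S. color k y = c}) -
      (real (limb_coordinate k lam c) - real (limb_coordinate k mu c))\<bar> \<le> real (2 * k)"
    by auto
qed

end

section \<open>The asymptotic formula\<close>

lemma tendsto_div_bounded_diff:
  fixes u v :: "nat \<Rightarrow> real"
  assumes lim: "(\<lambda>n. u n / real n) \<longlonglongrightarrow> a" and bound: "\<forall>\<^sub>F n in sequentially. \<bar>v n - u n\<bar> \<le> K"
  shows "(\<lambda>n. v n / real n) \<longlonglongrightarrow> a"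
proof -
  have "(\<lambda>n. (v n - u n) / real n) \<longlonglongrightarrow> 0"
  proof (rule tendsto_0_le)
    show "\<forall>\<^sub>F n in sequentially. norm ((v n - u n) / real n) \<le> norm (K / real n) * 1"
      using bound by eventually_elim (auto simp: intro!: divide_right_mono)
    show "(\<lambda>n. K / real n) \<longlonglongrightarrow> 0" by (rule lim_const_over_n)
  qed
  from tendsto_add[OF lim this] show ?thesis by (simp add: diff_divide_distrib)
qed

lemma sum_split_double: "(\<Sum>c\<in>{1..2 * k}. h c) = (\<Sum>i=1..k. h i) + (\<Sum>i=1..k. h (k + i))"
  for h :: "nat \<Rightarrow> 'a :: comm_monoid_add"
proof -
  have "{1..2 * k} = {1..k} \<union> {k + 1..k + k}" by auto
  hence "(\<Sum>c\<in>{1..2 * k}. h c) = (\<Sum>i=1..k. h i) + (\<Sum>c=k+1..k+k. h c)"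
    by (simp only:) (rule sum.union_disjoint, auto)
  also have "(\<Sum>c=k+1..k+k. h c) = (\<Sum>i=1..k. h (k + i))"
    using sum.shift_bounds_cl_nat_ivl[of h 1 k k] by (simp add: add.commute)
  finally show ?thesis .
qed

lemma xlogx_divide: "x \<ge> 0 \<Longrightarrow> L > 0 \<Longrightarrow> xlogx (x / L) = (xlogx x - x * ln L) / L"
  by (cases "x = 0") (auto simp: xlogx_def ln_div field_simps)

theorem theorem5p1:
  fixes k :: nat
    and \<alpha> \<beta> \<pi> \<tau> :: "nat \<Rightarrow> real"
    and lam mu :: "nat \<Rightarrow> nat list"
    and \<gamma> c :: real
  assumes "k \<ge> 1"
    and "\<And>i. i \<in> {1..k} \<Longrightarrow> \<alpha> i \<ge> 0 \<and> \<beta> i \<ge> 0 \<and> \<pi> i \<ge> 0 \<and> \<tau> i \<ge> 0"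
    and "\<alpha> 1 > 0" and "\<beta> 1 > 0"
    and "\<And>n. n \<ge> 1 \<Longrightarrow> is_skew_shape (lam n) (mu n)"
    and "\<And>n. n \<ge> 1 \<Longrightarrow> cells_connected (skew_diagram (lam n) (mu n))"
    and "TVK_limit k lam \<alpha> \<beta>"
    and "TVK_limit k mu \<pi> \<tau>"
  defines "\<gamma> \<equiv> (\<Sum>i=1..k. \<alpha> i + \<beta> i - \<pi> i - \<tau> i)"
    and "c \<equiv> xlogx \<gamma> - (\<Sum>i=1..k. xlogx (\<alpha> i - \<pi> i)) - (\<Sum>i=1..k. xlogx (\<beta> i - \<tau> i))"
  shows "(\<lambda>n. ln (real (num_SYT (lam n) (mu n))) - c * real n) \<in> o(\<lambda>n. real n)"
proof -
  let ?C = "{1..2 * k}"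
  let ?e = "\<lambda>n. ln (real (num_SYT (lam n) (mu n))) / real n"
  \<comment> \<open>Arms and legs become one vector of limits indexed by colours, so that the
    entropy is a single sum.\<close>
  define a where "a i = (if i \<le> k then \<alpha> i - \<pi> i else \<beta> (i - k) - \<tau> (i - k))" for i
  define whole where "whole i n = card {y\<in>skew_diagram (lam n) (mu n). color k y = i}" for i n
  define piece where "piece L s i n =
    card {y\<in>{y\<in>skew_diagram (lam n) (mu n). stage L k (lam n) (mu n) y = s}. color k y = i}" for L s i n
  have thin: "thin_skew_shape (lam n) (mu n) k" if "n \<ge> 1" for n
    using assms(5)[OF that] assms(7,8) that by (auto simp: thin_skew_shape_def TVK_limit_def)
  have coord: "(\<lambda>n. (real (limb_coordinate k (lam n) i) - real (limb_coordinate k (mu n) i)) / real n)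
    \<longlonglongrightarrow> a i" if "i \<in> ?C" for i
  proof (cases "i \<le> k")
    case True
    thus ?thesis using assms(7,8) that
      by (auto simp: TVK_limit_def limb_coordinate_def a_def diff_divide_distrib intro: tendsto_diff)
  next
    case False
    hence "i - k \<in> {1..k}" using that by auto
    thus ?thesis using assms(7,8) False
      unfolding TVK_limit_def limb_coordinate_def a_def diff_divide_distrib
      by (auto intro: tendsto_diff)
  qed
  have whole_lim: "(\<lambda>n. real (whole i n) / real n) \<longlonglongrightarrow> a i" if "i \<in> ?C" for i
  proof (rule tendsto_div_bounded_diff[OF coord[OF that]])
    show "\<forall>\<^sub>F n in sequentially. \<bar>real (whole i n) -
      (real (limb_coordinate k (lam n) i) - real (limb_coordinate k (mu n) i))\<bar> \<le> real (2 * k)"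
      using eventually_ge_at_top[of 1] unfolding whole_def
      by eventually_elim (rule thin_skew_shape.limb_length_approx(2)[OF thin that])
  qed
  have limb_lim: "(\<lambda>n. real (limb_length k (lam n) (mu n) i) / real n) \<longlonglongrightarrow> a i" if "i \<in> ?C" for i
  proof (rule tendsto_div_bounded_diff[OF coord[OF that]])
    show "\<forall>\<^sub>F n in sequentially. \<bar>real (limb_length k (lam n) (mu n) i) -
      (real (limb_coordinate k (lam n) i) - real (limb_coordinate k (mu n) i))\<bar> \<le> real (2 * k)"
      using eventually_ge_at_top[of 1]
      by eventually_elim (rule thin_skew_shape.limb_length_approx(1)[OF thin that])
  qed
  \<comment> \<open>While \<open>L\<close> and \<open>s\<close> are fixed, the rounding error of one
    cell per block disappears after division by \<open>n\<close>.\<close>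
  have piece_lim: "(\<lambda>n. real (piece L s i n) / real n) \<longlonglongrightarrow> a i / real L"
    if "k < s" "s \<le> L" "i \<in> ?C" for L s i
  proof (rule tendsto_div_bounded_diff)
    show "(\<lambda>n. real (limb_length k (lam n) (mu n) i) / real L / real n) \<longlonglongrightarrow> a i / real L"
      using tendsto_divide[OF limb_lim[OF that(3)] tendsto_const[of "real L"]] that
      by (simp add: mult.commute)
    show "\<forall>\<^sub>F n in sequentially. \<bar>real (piece L s i n) - real (limb_length k (lam n) (mu n) i) / real L\<bar> \<le> 1"
      using eventually_ge_at_top[of 1] unfolding piece_def
      by eventually_elim (rule thin_skew_shape.card_stage_color[OF thin that])
  qed
  \<comment> \<open>Each entry is a limit of numbers of cells divided by \<open>n\<close>.\<close>
  have a_nonneg: "a i \<ge> 0" if "i \<in> ?C" for i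
    using whole_lim[OF that] by (rule LIMSEQ_le_const) auto
  have c: "c = xlogx (\<Sum>i\<in>?C. a i) - (\<Sum>i\<in>?C. xlogx (a i))"
  proof -
    have "\<gamma> = (\<Sum>i\<in>?C. a i)"
      unfolding sum_split_double \<gamma>_def by (simp add: a_def flip: sum.distrib) 
        (intro sum.cong refl, auto)
    moreover have "(\<Sum>i\<in>?C. xlogx (a i)) =
      (\<Sum>i=1..k. xlogx (\<alpha> i - \<pi> i)) + (\<Sum>i=1..k. xlogx (\<beta> i - \<tau> i))"
      unfolding sum_split_double by (intro arg_cong2[of _ _ _ _ "(+)"] sum.cong refl) (auto simp: a_def)
    ultimately show ?thesis by (simp add: c_def)
  qed
  have upper: "\<forall>\<^sub>F n in sequentially. ?e n < y" if "c < y" for y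
  proof -
    have "(\<lambda>n. (ln (fact (\<Sum>i\<in>?C. whole i n)) - (\<Sum>i\<in>?C. ln (fact (whole i n)))) / real n) \<longlonglongrightarrow> c"
      unfolding c by (rule tendsto_ln_multinomial[OF whole_lim])
    from order_tendstoD(2)[OF this that] eventually_ge_at_top[of 1] show ?thesis
    proof eventually_elim
      case (elim n)
      have "?e n \<le> (ln (fact (\<Sum>i\<in>?C. whole i n)) - (\<Sum>i\<in>?C. ln (fact (whole i n)))) / real n"
        unfolding whole_def by (intro divide_right_mono thin_skew_shape.ln_num_SYT_le thin elim) auto
      thus ?case using elim(1) by (rule le_less_trans)
    qed
  qed
  have lower: "\<forall>\<^sub>F n in sequentially. ?e n > y" if "y < c" for y
  proof -
    \<comment> \<open>This is \<open>(L - k) c / L\<close>, the total of the \<open>L - k\<close>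
      kept stages at \<open>c / L\<close> each. The number \<open>L\<close> is chosen from
      \<open>y\<close> before \<open>n\<close> grows.\<close>
    have "(\<lambda>L. c - c * real k / real L) \<longlonglongrightarrow> c - 0"
      by (intro tendsto_diff tendsto_const lim_const_over_n)
    hence "\<forall>\<^sub>F L in sequentially. y < c - c * real k / real L"
      using that by (intro order_tendstoD(1)) auto
    with eventually_gt_at_top[of k] have "\<forall>\<^sub>F L in sequentially. k < L \<and> y < c - c * real k / real L"
      by eventually_elim auto
    then obtain L where L: "k < L" "y < c - c * real k / real L"
      by (auto dest: eventually_happens)
    \<comment> \<open>The entropy is homogeneous of degree one: the \<open>ln L\<close> terms cancel
      between the total and the parts.\<close>
    have c_L: "xlogx (\<Sum>i\<in>?C. a i / real L) - (\<Sum>i\<in>?C. xlogx (a i / real L)) = c / real L"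
    proof -
      have "xlogx ((\<Sum>i\<in>?C. a i) / real L) = (xlogx (\<Sum>i\<in>?C. a i) - (\<Sum>i\<in>?C. a i) * ln (real L)) / real L"
        using L by (intro xlogx_divide sum_nonneg a_nonneg) auto
      moreover have "(\<Sum>i\<in>?C. xlogx (a i / real L)) = (\<Sum>i\<in>?C. (xlogx (a i) - a i * ln (real L)) / real L)"
        using L by (intro sum.cong refl xlogx_divide a_nonneg) auto
      ultimately show ?thesis
        unfolding c by (simp add: sum_subtractf sum_distrib_right diff_divide_distrib flip: sum_divide_distrib)
    qed
    let ?m = "\<lambda>s n. ln (fact (\<Sum>i\<in>?C. piece L s i n)) - (\<Sum>i\<in>?C. ln (fact (piece L s i n)))"
    have "(\<lambda>n. \<Sum>s\<in>{k<..L}. ?m s n / real n) \<longlonglongrightarrow> (\<Sum>s\<in>{k<..L}. c / real L)"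
      unfolding c_L[symmetric]
      by (intro tendsto_sum tendsto_ln_multinomial piece_lim) auto
    moreover have "(\<Sum>s\<in>{k<..L}. c / real L) = c - c * real k / real L"
      using L(1) by (simp add: of_nat_diff field_simps)
    ultimately have "(\<lambda>n. (\<Sum>s\<in>{k<..L}. ?m s n) / real n) \<longlonglongrightarrow> c - c * real k / real L"
      by (simp add: sum_divide_distrib)
    from order_tendstoD(1)[OF this L(2)] eventually_ge_at_top[of 1] show ?thesis
    proof eventually_elim
      case (elim n)
      have "(\<Sum>s\<in>{k<..L}. ?m s n) / real n \<le> ?e n"
        unfolding piece_def by (intro divide_right_mono thin_skew_shape.ln_num_SYT_ge thin elim L) auto
      with elim(1) show ?case by (rule less_le_trans)
    qed
  qed
  have "?e \<longlonglongrightarrow> c" using lower upper by (intro order_tendstoI) auto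
  hence "(\<lambda>n. ?e n - c) \<longlonglongrightarrow> 0" by (simp add: LIM_zero_iff)
  \<comment> \<open>At \<open>n = 0\<close> division by zero gives \<open>- c\<close> on the left
    and 0 on the right, so the equality starts at 1.\<close>
  moreover have "\<forall>\<^sub>F n in sequentially.
      ?e n - c = (ln (real (num_SYT (lam n) (mu n))) - c * real n) / real n"
    using eventually_ge_at_top[of 1] by eventually_elim (simp add: diff_divide_distrib)
  ultimately have "(\<lambda>n. (ln (real (num_SYT (lam n) (mu n))) - c * real n) / real n) \<longlonglongrightarrow> 0"
    by (rule Lim_transform_eventually)
  thus ?thesis
    by (intro smalloI_tendsto) (auto intro: eventually_mono[OF eventually_gt_at_top[of 0]])
qed

end
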